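(* Let $N$ be a positive integer and let $q\neq 1$ be a complex number such that $[n]_q\neq 0$ for all $1\le n\le N-1$. For every index $\boldsymbol{k}=(k_1,\ldots,k_r)$ (a tuple of positive integers, $r\geq 1$), we have $$\zeta^{BZ}_{<N}(\boldsymbol{k};q)=\zeta^{q\flat}_{<N}(\boldsymbol{k}),$$ where $$\zeta_{<N}^{BZ}(\boldsymbol{k};q)=\sum_{0<m_1<\cdots<m_r<N}\frac{q^{(k_1-1)m_1+\cdots+(k_r-1)m_r}}{[m_1]_q^{k_1}\cdots[m_r]_q^{k_r}}$$ and $$\zeta_{<N}^{q\flat}(\boldsymbol{k})=\sum\prod_{j=1}^{r}\frac{q^{n_{j2}+\cdots+n_{jk_j}}}{[N-n_{j1}]_q\,[n_{j2}]_q\cdots[n_{jk_j}]_q},$$ the last sum running over all families of integers $(n_{jl})_{1\le j\le r,\,1\le l\le k_j}$ with $0<n_{j1}\le n_{j2}\le\cdots\le n_{jk_j}<N$ for $1\le j\le r$ and $n_{jk_j}<n_{(j+1)1}$ for $1\le j<r$.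
   Context: The $q$-integer is $[n]_q=(1-q^n)/(1-q)$ for $n\in\mathbb{Z}_{\ge0}$, with $[0]_q=0$. All sums range over integers; an empty sum is $0$. When $k_j=1$ the $j$-th factor of the product is $1/[N-n_{j1}]_q$. *)

theory Defs
  imports Complex_Main "HOL-Library.FuncSet"
begin

text \<open>
  An index of depth \<open>r\<close> is a function \<open>k :: nat \<Rightarrow> nat\<close>, of which only the values
  \<open>k 1, \<dots>, k r\<close> are used. A family indexed by a finite set is an extensional function on
  that set, so that each family is counted exactly once in a sum.
\<close>

definition q_int :: "complex \<Rightarrow> nat \<Rightarrow> complex" where
  "q_int q n = (1 - q ^ n) / (1 - q)"

definition BZ_range :: "nat \<Rightarrow> nat \<Rightarrow> (nat \<Rightarrow> nat) set" where
  "BZ_range N r = {m \<in> extensional {1..r}.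
     (\<forall>j\<in>{1..r}. 0 < m j \<and> m j < N) \<and> (\<forall>j\<in>{1..<r}. m j < m (j + 1))}"

definition zeta_BZ :: "nat \<Rightarrow> nat \<Rightarrow> (nat \<Rightarrow> nat) \<Rightarrow> complex \<Rightarrow> complex" where
  "zeta_BZ N r k q = (\<Sum>m\<in>BZ_range N r.
     q ^ (\<Sum>j=1..r. (k j - 1) * m j) / (\<Prod>j=1..r. q_int q (m j) ^ k j))"

definition flat_range :: "nat \<Rightarrow> nat \<Rightarrow> (nat \<Rightarrow> nat) \<Rightarrow> (nat \<times> nat \<Rightarrow> nat) set" where
  "flat_range N r k = {n \<in> extensional (SIGMA j:{1..r}. {1..k j}).
     (\<forall>j\<in>{1..r}. 0 < n (j, 1) \<and> (\<forall>l\<in>{1..<k j}. n (j, l) \<le> n (j, l + 1)) \<and> n (j, k j) < N) \<and>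
     (\<forall>j\<in>{1..<r}. n (j, k j) < n (j + 1, 1))}"

definition zeta_flat :: "nat \<Rightarrow> nat \<Rightarrow> (nat \<Rightarrow> nat) \<Rightarrow> complex \<Rightarrow> complex" where
  "zeta_flat N r k q = (\<Sum>n\<in>flat_range N r k. \<Prod>j=1..r.
     q ^ (\<Sum>l=2..k j. n (j, l)) /
     (q_int q (N - n (j, 1)) * (\<Prod>l=2..k j. q_int q (n (j, l)))))"

text \<open>
  Both ranges are finite, so neither sum takes the default value of a sum over an infinite set.
\<close>

lemma finite_BZ_range: "finite (BZ_range N r)"
proof (rule finite_subset)
  show "BZ_range N r \<subseteq> {1..r} \<rightarrow>\<^sub>E {..<N}"
    by (auto simp: BZ_range_def PiE_def)
qed (auto intro: finite_PiE)

lemma finite_flat_range: "finite (flat_range N r k)"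
proof (rule finite_subset)
  show "flat_range N r k \<subseteq> (SIGMA j:{1..r}. {1..k j}) \<rightarrow>\<^sub>E {..<N}"
  proof
    fix n assume n: "n \<in> flat_range N r k"
    have "n (j, l) < N" if j: "j \<in> {1..r}" and l: "1 \<le> l" "l \<le> k j" for j l
      using l(2,1)
    proof (induction rule: inc_induct)
      case base
      then show ?case using n j by (auto simp: flat_range_def)
    next
      case (step i)
      then have "n (j, i) \<le> n (j, i + 1)" using n j by (auto simp: flat_range_def)
      then show ?case using step by auto
    qed
    then show "n \<in> (SIGMA j:{1..r}. {1..k j}) \<rightarrow>\<^sub>E {..<N}"
      using n by (auto simp: flat_range_def PiE_def)
  qed
qed (auto intro!: finite_PiE finite_SigmaI)

end

theory Submission
  imports Defs
begin

text \<open>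
  The discrete analogue \<open>P\<^sub>m(n) = [n choose m]\<^sub>q / [N - 1 choose m]\<^sub>q\<close> of the monomial \<open>(n/N)\<^sup>m\<close> behaves
  under summation as monomials do under the two differential forms of the iterated integral of a
  multiple zeta value: weighted summation against \<open>q\<^sup>a/[a]\<^sub>q\<close> multiplies \<open>P\<^sub>m\<close> by \<open>q\<^sup>m/[m]\<^sub>q\<close>, and
  summation against \<open>1/[N - a]\<^sub>q\<close> turns \<open>P\<^sub>m\<close> into the sum of \<open>P\<^sub>b/[b]\<^sub>q\<close> over all \<open>b > m\<close>. Hence, by
  induction on the index, the flat sum with all variables at most \<open>n\<close> is the Bradley--Zhao sum with
  the extra factor \<open>P\<^bsub>m\<^sub>r\<^esub>(n)\<close>, which is \<open>1\<close> for \<open>n = N - 1\<close>.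
\<close>

section \<open>Discrete monomials\<close>

lemma q_int_0 [simp]: "q_int q 0 = 0"
  by (simp add: q_int_def)

lemma q_int_add: "q_int q (a + b) = q_int q a + q ^ a * q_int q b"
  by (simp add: q_int_def add_divide_distrib [symmetric] power_add algebra_simps)

lemma q_int_diff: "b \<le> a \<Longrightarrow> q_int q a - q_int q b = q ^ b * q_int q (a - b)"
  using q_int_add [of q b "a - b"] by simp

text \<open>
  The truncated subtraction is harmless: if \<open>n < m\<close> then the factor with \<open>i = n\<close> vanishes, as it
  should.
\<close>
definition discrete_monom :: "nat \<Rightarrow> complex \<Rightarrow> nat \<Rightarrow> nat \<Rightarrow> complex" where
  "discrete_monom N q m n = (\<Prod>i<m. q_int q (n - i)) / (\<Prod>i<m. q_int q (N - 1 - i))"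

lemma prod_q_int_eq_0: "n < m \<Longrightarrow> (\<Prod>i<m. q_int q (n - i)) = 0"
  by (auto intro!: bexI [of _ n])

lemma discrete_monom_0 [simp]: "discrete_monom N q 0 n = 1"
  by (simp add: discrete_monom_def)

lemma discrete_monom_eq_0: "n < m \<Longrightarrow> discrete_monom N q m n = 0"
  unfolding discrete_monom_def by (simp only: prod_q_int_eq_0 div_0)

lemma discrete_monom_Suc:
  "discrete_monom N q (Suc m) n =
     discrete_monom N q m n * q_int q (n - m) / q_int q (N - 1 - m)"
  by (simp add: discrete_monom_def)

text \<open>The first factor of the product splits off and the others shift. Together with
  \<open>discrete_monom_Suc\<close> this makes both P_{m+1}(n+1) and P_{m+1}(n) multiples of P_m(n),
  so that their difference can be computed.\<close>

lemma discrete_monom_Suc_Suc: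
  "discrete_monom N q (Suc m) (Suc n) =
     discrete_monom N q m n * q_int q (Suc n) / q_int q (N - 1 - m)"
  by (simp add: discrete_monom_def prod.lessThan_Suc_shift [where n = m and g = "\<lambda>i. q_int q (Suc n - i)"]
      del: prod.lessThan_Suc) (simp add: mult.commute)

section \<open>Difference and summation formulas for discrete monomials\<close>

context
  fixes N :: nat and q :: complex
  assumes nonzero: "\<And>n. 1 \<le> n \<Longrightarrow> n \<le> N - 1 \<Longrightarrow> q_int q n \<noteq> 0"
begin

lemma discrete_monom_top: "m \<le> N - 1 \<Longrightarrow> discrete_monom N q m (N - 1) = 1"
  unfolding discrete_monom_def using nonzero by (simp add: prod_zero_iff)

text \<open>Discrete form of d(x^(s+1))/(s+1) = (x^s - x^(s+1)) dx/(1 - x). For s \<le> n both sides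
  equal q^(n-s) P_s(n)/[N-1-s]; for n < s everything vanishes.\<close>

lemma discrete_monom_Suc_diff:
  assumes "Suc s < N" "Suc n < N"
  shows "(discrete_monom N q (Suc s) (Suc n) - discrete_monom N q (Suc s) n) / q_int q (Suc s) =
         (discrete_monom N q s n - discrete_monom N q (Suc s) n) / q_int q (N - Suc n)"
proof (cases "n < s")
  case True
  then show ?thesis by (simp add: discrete_monom_eq_0)
next
  case False
  have nz: "q_int q (Suc s) \<noteq> 0" "q_int q (N - Suc n) \<noteq> 0" "q_int q (N - 1 - s) \<noteq> 0"
    by (rule nonzero; use assms in simp)+
  have 1: "q_int q (Suc n) - q_int q (n - s) = q ^ (n - s) * q_int q (Suc s)"
    using q_int_diff [of "n - s" "Suc n" q] False by simp
  have 2: "q_int q (N - 1 - s) - q_int q (n - s) = q ^ (n - s) * q_int q (N - Suc n)"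
    using q_int_diff [of "n - s" "N - 1 - s" q] False assms by simp
  have "discrete_monom N q (Suc s) (Suc n) - discrete_monom N q (Suc s) n =
      discrete_monom N q s n / q_int q (N - 1 - s) * (q_int q (Suc n) - q_int q (n - s))"
    unfolding discrete_monom_Suc_Suc discrete_monom_Suc [of N q s n]
    by (simp add: algebra_simps diff_divide_distrib)
  moreover have "discrete_monom N q s n - discrete_monom N q (Suc s) n =
      discrete_monom N q s n / q_int q (N - 1 - s) * (q_int q (N - 1 - s) - q_int q (n - s))"
    unfolding discrete_monom_Suc using nz by (simp add: field_simps)
  ultimately show ?thesis
    unfolding 1 2 using nz by simp
qed

text \<open>Discrete form of integrating x^t/(1 - x) to the sum of x^b/b over b > t. In the
  induction on \<open>n\<close>, the increment of the right-hand side telescopes over b by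
  \<open>discrete_monom_Suc_diff\<close>.\<close>

lemma sum_discrete_monom_flat:
  assumes "t < N" "n < N"
  shows "(\<Sum>a=1..n. discrete_monom N q t (a - 1) / q_int q (N - a)) =
         (\<Sum>b\<in>{t<..<N}. discrete_monom N q b n / q_int q b)"
  using assms(2)
proof (induction n)
  case 0
  then show ?case by (simp add: discrete_monom_eq_0)
next
  case (Suc n)
  have "(\<Sum>b\<in>{t<..<N}. discrete_monom N q b (Suc n) / q_int q b) -
        (\<Sum>b\<in>{t<..<N}. discrete_monom N q b n / q_int q b) =
        (\<Sum>b\<in>{t<..<N}. (discrete_monom N q b (Suc n) - discrete_monom N q b n) / q_int q b)"
    by (simp add: sum_subtractf diff_divide_distrib)
  also have "\<dots> = (\<Sum>b\<in>Suc ` {t..<N - 1}. (discrete_monom N q b (Suc n) - discrete_monom N q b n) / q_int q b)"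
    using assms(1) by (intro sum.cong) (auto simp: image_Suc_atLeastLessThan)
  also have "\<dots> =
      (\<Sum>s=t..<N - 1. (discrete_monom N q s n - discrete_monom N q (Suc s) n) / q_int q (N - Suc n))"
    using Suc.prems by (subst sum.reindex) (auto intro!: sum.cong discrete_monom_Suc_diff)
  also have "\<dots> = (\<Sum>s=t..<N - 1. discrete_monom N q s n - discrete_monom N q (Suc s) n) / q_int q (N - Suc n)"
    by (simp add: sum_divide_distrib)
  also have "(\<Sum>s=t..<N - 1. discrete_monom N q s n - discrete_monom N q (Suc s) n) =
      discrete_monom N q t n - discrete_monom N q (N - 1) n"
    using sum_Suc_diff' [of t "N - 1" "\<lambda>s. - discrete_monom N q s n"] assms(1)
    by simp
  \<comment> \<open>\<open>Suc n < N\<close> puts n below N - 1, so the far end of the telescope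
    vanishes and exactly the new summand a = \<open>Suc n\<close> remains.\<close>
  also have "discrete_monom N q (N - 1) n = 0"
    using Suc.prems by (intro discrete_monom_eq_0) simp
  finally show ?case
    using Suc by (simp add: algebra_simps)
qed

text \<open>Discrete form of integrating x^b/x to x^b/b. The summand is itself a difference: q^a/[a]
  P_b(a) = q^b/[b] (P_b(a) - P_b(a-1)).\<close>

lemma sum_discrete_monom_power:
  assumes "1 \<le> b" "b < N" "n < N"
  shows "(\<Sum>a=1..n. q ^ a / q_int q a * discrete_monom N q b a) =
         q ^ b / q_int q b * discrete_monom N q b n"
  using assms(3)
proof (induction n)
  case 0
  then show ?case using assms by (simp add: discrete_monom_eq_0)
next
  case (Suc n)
  obtain s where b: "b = Suc s" using assms(1) by (cases b) auto
  have nz: "q_int q (Suc s) \<noteq> 0" "q_int q (Suc n) \<noteq> 0" "q_int q (N - 1 - s) \<noteq> 0"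
    by (rule nonzero; use assms Suc.prems b in simp)+
  \<comment> \<open>This is the difference formula for the summand at a = \<open>Suc n\<close>, with
    denominators cleared.\<close>
  have "q ^ Suc s * (discrete_monom N q (Suc s) (Suc n) - discrete_monom N q (Suc s) n) * q_int q (Suc n) =
        q ^ Suc n * discrete_monom N q (Suc s) (Suc n) * q_int q (Suc s)"
  proof (cases "n < s")
    case True
    then show ?thesis by (simp add: discrete_monom_eq_0)
  next
    case False
    have 1: "q_int q (Suc n) - q_int q (n - s) = q ^ (n - s) * q_int q (Suc s)"
      using q_int_diff [of "n - s" "Suc n" q] False by simp
    have 2: "q ^ Suc n = q ^ Suc s * q ^ (n - s)"
      using False by (simp flip: power_add)
    have "discrete_monom N q (Suc s) (Suc n) - discrete_monom N q (Suc s) n =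
        discrete_monom N q s n / q_int q (N - 1 - s) * (q_int q (Suc n) - q_int q (n - s))"
      unfolding discrete_monom_Suc_Suc discrete_monom_Suc [of N q s n]
      by (simp add: algebra_simps diff_divide_distrib)
    then show ?thesis
      unfolding 1 2 discrete_monom_Suc_Suc by (simp add: mult_ac)
  qed
  then have "q ^ Suc n / q_int q (Suc n) * discrete_monom N q b (Suc n) =
      q ^ b / q_int q b * (discrete_monom N q b (Suc n) - discrete_monom N q b n)"
    unfolding b using nz by (simp add: frac_eq_eq mult_ac del: power_Suc)
  then show ?case
    using Suc by (simp add: algebra_simps)
qed

end

section \<open>Removing the last variable\<close>

definition BZ_weight :: "nat \<Rightarrow> (nat \<Rightarrow> nat) \<Rightarrow> complex \<Rightarrow> (nat \<Rightarrow> nat) \<Rightarrow> complex" where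
  "BZ_weight r k q m = (\<Prod>j=1..r. q ^ ((k j - 1) * m j) / q_int q (m j) ^ k j)"

text \<open>The convention \<open>m\<^sub>0 = 0\<close>; an extensional \<open>m\<close> has the value \<open>undefined\<close> there.\<close>
definition last_entry :: "nat \<Rightarrow> (nat \<Rightarrow> nat) \<Rightarrow> nat" where
  "last_entry r m = (if r = 0 then 0 else m r)"

lemma last_entry_less: "N \<ge> 1 \<Longrightarrow> m \<in> BZ_range N r \<Longrightarrow> last_entry r m < N"
  by (auto simp: last_entry_def BZ_range_def)

lemma zeta_BZ_eq: "zeta_BZ N r k q = (\<Sum>m\<in>BZ_range N r. BZ_weight r k q m)"
  by (simp add: zeta_BZ_def BZ_weight_def prod_dividef power_sum)

lemma BZ_weight_upd:
  "BZ_weight (Suc r) k q (m(Suc r := b)) =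
     BZ_weight r k q m * (q ^ ((k (Suc r) - 1) * b) / q_int q b ^ k (Suc r))"
  by (simp add: BZ_weight_def)

lemma BZ_range_0: "BZ_range N 0 = {\<lambda>_. undefined}"
  by (auto simp: BZ_range_def)

text \<open>The new largest variable b only has to exceed the previous one. The value 0 of
  \<open>last_entry\<close> at r = 0 makes positivity of the first variable an instance of the same
  condition.\<close>

lemma sum_BZ_range_Suc:
  "(\<Sum>m\<in>BZ_range N (Suc r). h m) =
     (\<Sum>m\<in>BZ_range N r. \<Sum>b\<in>{last_entry r m<..<N}. h (m(Suc r := b)))"
proof -
  have "(\<Sum>m\<in>BZ_range N r. \<Sum>b\<in>{last_entry r m<..<N}. h (m(Suc r := b))) =
      (\<Sum>(m, b)\<in>(SIGMA m:BZ_range N r. {last_entry r m<..<N}). h (m(Suc r := b)))"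
    by (rule sum.Sigma) (auto simp: finite_BZ_range)
  also have "\<dots> = (\<Sum>m\<in>BZ_range N (Suc r). h m)"
  proof (rule sum.reindex_bij_witness [where i = "\<lambda>m. (m(Suc r := undefined), m (Suc r))"
        and j = "\<lambda>(m, b). m(Suc r := b)"], goal_cases)
    case (1 x)
    then show ?case
      by (auto simp: BZ_range_def fun_eq_iff extensional_def)
  next
    case (2 x)
    then show ?case
      by (auto simp: BZ_range_def last_entry_def extensional_def less_Suc_eq)
  next
    case (3 m)
    then show ?case by simp
  next
    case (4 m)
    then show ?case
      by (auto simp: BZ_range_def last_entry_def extensional_def)
  next
    case (5 x)
    then show ?case by auto
  qed
  finally show ?thesis ..
qed

section \<open>Flat sums\<close>

definition flat_weight ::
  "nat \<Rightarrow> nat \<Rightarrow> (nat \<Rightarrow> nat) \<Rightarrow> complex \<Rightarrow> (nat \<times> nat \<Rightarrow> nat) \<Rightarrow> complex" where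
  "flat_weight N r k q n = (\<Prod>j=1..r. q ^ (\<Sum>l=2..k j. n (j, l)) /
     (q_int q (N - n (j, 1)) * (\<Prod>l=2..k j. q_int q (n (j, l)))))"

text \<open>The variables are bounded by \<open>M\<close> while the weight keeps the original \<open>N\<close>.\<close>
definition flat_partial :: "nat \<Rightarrow> nat \<Rightarrow> nat \<Rightarrow> (nat \<Rightarrow> nat) \<Rightarrow> complex \<Rightarrow> complex" where
  "flat_partial N M r k q = (\<Sum>n\<in>flat_range M r k. flat_weight N r k q n)"

lemma zeta_flat_eq: "zeta_flat N r k q = flat_partial N N r k q"
  by (simp add: zeta_flat_def flat_partial_def flat_weight_def)

lemma flat_partial_0: "flat_partial N M 0 k q = 1"
proof -
  have "flat_range M 0 k = {\<lambda>_. undefined}"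
    by (auto simp: flat_range_def)
  then show ?thesis by (simp add: flat_partial_def flat_weight_def)
qed

text \<open>The variables increase along and across the rows, so the bound M matters only at the
  very last one. Once that variable is removed, its value can serve as the bound for the
  rest.\<close>

lemma flat_range_iff:
  assumes "r \<ge> 1" "\<forall>j\<in>{1..r}. k j \<ge> 1"
  shows "n \<in> flat_range M r k \<longleftrightarrow> n \<in> extensional (SIGMA j:{1..r}. {1..k j}) \<and>
     (\<forall>j\<in>{1..r}. 0 < n (j, 1) \<and> (\<forall>l\<in>{1..<k j}. n (j, l) \<le> n (j, Suc l))) \<and>
     (\<forall>j\<in>{1..<r}. n (j, k j) < n (Suc j, 1)) \<and> n (r, k r) < M"
    (is "_ \<longleftrightarrow> ?R")
proof
  assume "n \<in> flat_range M r k"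
  then show ?R using assms by (auto simp: flat_range_def)
next
  assume R: ?R
  have row: "n (j, 1) \<le> n (j, k j)" if "j \<in> {1..r}" for j
  proof -
    have "n (j, 1) \<le> n (j, l)" if "1 \<le> l" "l \<le> k j" for l
      using that
    proof (induction l rule: dec_induct)
      case (step i)
      then have "n (j, i) \<le> n (j, Suc i)" using R \<open>j \<in> {1..r}\<close> by auto
      then show ?case using step by simp
    qed simp
    then show ?thesis using assms that by auto
  qed
  \<comment> \<open>The bound is carried downwards from row r to row j.\<close>
  have "n (j, k j) < M" if "1 \<le> j" "j \<le> r" for j
    using that(2,1)
  proof (induction rule: inc_induct)
    case base
    then show ?case using R by auto
  next
    case (step i)
    then have "n (i, k i) < n (Suc i, 1)" using R by auto
    also have "\<dots> \<le> n (Suc i, k (Suc i))" using row [of "Suc i"] step by auto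
    finally show ?case using step by auto
  qed
  then show "n \<in> flat_range M r k"
    using R by (auto simp: flat_range_def)
qed

lemma extensional_insert_iff: "f \<in> extensional (insert x A) \<longleftrightarrow> f(x := undefined) \<in> extensional A"
  by (auto simp: extensional_def)

lemma flat_weight_upd_first:
  assumes "k (Suc r) = 1"
  shows "flat_weight N (Suc r) k q (n((Suc r, 1) := a)) = flat_weight N r k q n / q_int q (N - a)"
proof -
  have "flat_weight N (Suc r) k q (n((Suc r, 1) := a)) =
      flat_weight N r k q (n((Suc r, 1) := a)) / q_int q (N - a)"
    using assms by (simp add: flat_weight_def)
  also have "flat_weight N r k q (n((Suc r, 1) := a)) = flat_weight N r k q n"
    by (auto simp: flat_weight_def intro!: prod.cong)
  finally show ?thesis .
qed

text \<open>The last row consists of a single variable a. The end of the previous row lies strictly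
  below a, so the remaining sum has bound a itself.\<close>

lemma flat_partial_first:
  assumes "k (Suc r) = 1" "\<forall>j\<in>{1..r}. k j \<ge> 1"
  shows "flat_partial N (Suc M) (Suc r) k q =
    (\<Sum>a=1..M. flat_partial N a r k q / q_int q (N - a))"
proof -
  let ?x = "(Suc r, 1 :: nat)"
  have mem: "n \<in> flat_range (Suc M) (Suc r) k \<longleftrightarrow>
     n ?x \<in> {1..M} \<and> n(?x := undefined) \<in> flat_range (n ?x) r k" for n
  proof (cases "r = 0")
    case True
    then show ?thesis
      using assms by (auto simp: flat_range_def extensional_def)
  next
    case False
    have k': "\<forall>j\<in>{1..Suc r}. k j \<ge> 1"
      using assms by (auto simp: le_Suc_eq)
    have ext: "n \<in> extensional (SIGMA j:{1..Suc r}. {1..k j}) \<longleftrightarrow>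
        n(?x := undefined) \<in> extensional (SIGMA j:{1..r}. {1..k j})"
    proof -
      have "(SIGMA j:{1..Suc r}. {1..k j}) = insert ?x (SIGMA j:{1..r}. {1..k j})"
        using assms(1) by (auto simp: le_Suc_eq)
      then show ?thesis by (simp only: extensional_insert_iff)
    qed
    have r: "r \<ge> 1" "Suc r \<ge> 1" using False by auto
    show ?thesis
      unfolding flat_range_iff [OF r(2) k'] flat_range_iff [OF r(1) assms(2)] ext
      using assms r by (auto simp: atLeastAtMostSuc_conv atLeastLessThanSuc)
  qed
  have "(\<Sum>a=1..M. flat_partial N a r k q / q_int q (N - a)) =
     (\<Sum>a=1..M. \<Sum>n\<in>flat_range a r k. flat_weight N (Suc r) k q (n(?x := a)))"
    using assms(1) by (simp only: flat_partial_def flat_weight_upd_first sum_divide_distrib)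
  also have "\<dots> = (\<Sum>(a, n)\<in>(SIGMA a:{1..M}. flat_range a r k). flat_weight N (Suc r) k q (n(?x := a)))"
    by (rule sum.Sigma) (auto simp: finite_flat_range)
  also have "\<dots> = (\<Sum>n\<in>flat_range (Suc M) (Suc r) k. flat_weight N (Suc r) k q n)"
  proof (rule sum.reindex_bij_witness [where i = "\<lambda>n. (n ?x, n(?x := undefined))"
        and j = "\<lambda>(a, n). n(?x := a)"], goal_cases)
    case (1 y)
    then show ?case
      by (auto simp: flat_range_def extensional_def fun_eq_iff)
  next
    case (2 y)
    then obtain a n where y: "y = (a, n)" "a \<in> {1..M}" "n \<in> flat_range a r k" by auto
    then have "n(?x := undefined) = n"
      by (auto simp: flat_range_def extensional_def fun_eq_iff)
    with y show ?case by (simp add: mem)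
  next
    case (3 n)
    then show ?case by simp
  next
    case (4 n)
    then show ?case by (simp add: mem)
  next
    case (5 y)
    then show ?case by auto
  qed
  finally show ?thesis by (simp add: flat_partial_def)
qed

text \<open>Since c \<ge> 1, the new variable sits at position 2 or later and contributes q^a/[a];
  only position 1 carries a factor 1/[N - a].\<close>

lemma flat_weight_upd_next:
  assumes "c \<ge> 1"
  shows "flat_weight N (Suc r) (k(Suc r := Suc c)) q (n((Suc r, Suc c) := a)) =
         q ^ a / q_int q a * flat_weight N (Suc r) (k(Suc r := c)) q n"
proof -
  have "(\<Prod>j=1..r. q ^ (\<Sum>l=2..(k(Suc r := Suc c)) j. (n((Suc r, Suc c) := a)) (j, l)) /
     (q_int q (N - (n((Suc r, Suc c) := a)) (j, 1)) *
       (\<Prod>l=2..(k(Suc r := Suc c)) j. q_int q ((n((Suc r, Suc c) := a)) (j, l))))) =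
     (\<Prod>j=1..r. q ^ (\<Sum>l=2..(k(Suc r := c)) j. n (j, l)) /
     (q_int q (N - n (j, 1)) * (\<Prod>l=2..(k(Suc r := c)) j. q_int q (n (j, l)))))"
    by (intro prod.cong) auto
  moreover have "(\<Sum>l=2..c. (n((Suc r, Suc c) := a)) (Suc r, l)) = (\<Sum>l=2..c. n (Suc r, l))"
    "(\<Prod>l=2..c. q_int q ((n((Suc r, Suc c) := a)) (Suc r, l))) = (\<Prod>l=2..c. q_int q (n (Suc r, l)))"
    by (auto intro!: sum.cong prod.cong)
  ultimately show ?thesis
    using assms by (simp add: flat_weight_def power_add mult_ac del: fun_upd_apply)
      (simp add: power_add mult_ac)
qed

text \<open>Within a row the order is weak: the variable before the removed a may equal a, so the
  remaining bound is \<open>Suc a\<close>, in contrast to \<open>flat_partial_first\<close>.\<close>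

lemma flat_partial_next:
  assumes "c \<ge> 1" "\<forall>j\<in>{1..r}. k j \<ge> 1"
  shows "flat_partial N (Suc M) (Suc r) (k(Suc r := Suc c)) q =
    (\<Sum>a=1..M. q ^ a / q_int q a * flat_partial N (Suc a) (Suc r) (k(Suc r := c)) q)"
proof -
  let ?x = "(Suc r, Suc c)" and ?k = "k(Suc r := Suc c)" and ?k' = "k(Suc r := c)"
  have k1: "\<forall>j\<in>{1..Suc r}. ?k j \<ge> 1" and k2: "\<forall>j\<in>{1..Suc r}. ?k' j \<ge> 1"
    using assms by auto
  \<comment> \<open>The removed variable is at least its predecessor, so positivity of the latter
    lets the sum over a start at 1.\<close>
  have last_pos: "n (Suc r, c) > 0" if "n \<in> flat_range L (Suc r) ?k'" for n L
  proof -
    have "n (Suc r, l) > 0" if "1 \<le> l" "l \<le> c" for l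
      using that
    proof (induction l rule: dec_induct)
      case base
      show ?case using \<open>n \<in> flat_range L (Suc r) ?k'\<close> by (auto simp: flat_range_def)
    next
      case (step i)
      then have "n (Suc r, i) \<le> n (Suc r, Suc i)"
        using \<open>n \<in> flat_range L (Suc r) ?k'\<close> by (auto simp: flat_range_def)
      then show ?case using step by simp
    qed
    then show ?thesis using assms by simp
  qed
  have mem: "n \<in> flat_range (Suc M) (Suc r) ?k \<longleftrightarrow>
     n ?x \<in> {1..M} \<and> n(?x := undefined) \<in> flat_range (Suc (n ?x)) (Suc r) ?k'" (is "?A \<longleftrightarrow> ?B") for n
  proof -
    have ext: "n \<in> extensional (SIGMA j:{1..Suc r}. {1..?k j}) \<longleftrightarrow>
        n(?x := undefined) \<in> extensional (SIGMA j:{1..Suc r}. {1..?k' j})"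
    proof -
      have "(SIGMA j:{1..Suc r}. {1..?k j}) = insert ?x (SIGMA j:{1..Suc r}. {1..?k' j})"
        by (auto simp: le_Suc_eq split: if_splits)
      then show ?thesis by (simp only: extensional_insert_iff)
    qed
    have r: "Suc r \<ge> 1" by simp
    have "?A \<longleftrightarrow> n ?x \<le> M \<and> n(?x := undefined) \<in> flat_range (Suc (n ?x)) (Suc r) ?k'"
      unfolding flat_range_iff [OF r k1] flat_range_iff [OF r k2] ext
      using assms(1) by (auto simp: atLeastAtMostSuc_conv atLeastLessThanSuc)
    moreover have "n ?x \<ge> 1" if "n(?x := undefined) \<in> flat_range (Suc (n ?x)) (Suc r) ?k'"
    proof -
      have "(n(?x := undefined)) (Suc r, ?k' (Suc r)) < Suc (n ?x)"
        using that unfolding flat_range_iff [OF r k2] by blast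
      then have "n (Suc r, c) \<le> n ?x" by simp
      then show ?thesis using last_pos [OF that] by simp
    qed
    ultimately show ?thesis by auto
  qed
  have "(\<Sum>a=1..M. q ^ a / q_int q a * flat_partial N (Suc a) (Suc r) ?k' q) =
     (\<Sum>a=1..M. \<Sum>n\<in>flat_range (Suc a) (Suc r) ?k'. flat_weight N (Suc r) ?k q (n(?x := a)))"
    by (simp only: flat_partial_def flat_weight_upd_next [OF assms(1)] sum_distrib_left)
  also have "\<dots> = (\<Sum>(a, n)\<in>(SIGMA a:{1..M}. flat_range (Suc a) (Suc r) ?k').
      flat_weight N (Suc r) ?k q (n(?x := a)))"
    by (rule sum.Sigma) (auto simp: finite_flat_range)
  also have "\<dots> = (\<Sum>n\<in>flat_range (Suc M) (Suc r) ?k. flat_weight N (Suc r) ?k q n)"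
  proof (rule sum.reindex_bij_witness [where i = "\<lambda>n. (n ?x, n(?x := undefined))"
        and j = "\<lambda>(a, n). n(?x := a)"], goal_cases)
    case (1 y)
    then show ?case
      by (auto simp: flat_range_def extensional_def fun_eq_iff)
  next
    case (2 y)
    then obtain a n where y: "y = (a, n)" "a \<in> {1..M}" "n \<in> flat_range (Suc a) (Suc r) ?k'" by auto
    then have "n(?x := undefined) = n"
      by (auto simp: flat_range_def extensional_def fun_eq_iff)
    with y show ?case by (simp add: mem)
  next
    case (3 n)
    then show ?case by simp
  next
    case (4 n)
    then show ?case by (simp add: mem)
  next
    case (5 y)
    then show ?case by auto
  qed
  finally show ?thesis by (simp add: flat_partial_def)
qed

section \<open>The interpolating identity\<close>

text \<open>Opening a row sums against 1/[N - a] and lengthening it sums against q^a/[a]; the two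
  summation formulas say what each does to the discrete monomial. Hence an induction on r with an
  inner one on the length of the last row.\<close>

lemma flat_partial_eq_sum_BZ_range:
  assumes nonzero: "\<And>n. 1 \<le> n \<Longrightarrow> n \<le> N - 1 \<Longrightarrow> q_int q n \<noteq> 0"
    and "\<forall>j\<in>{1..r}. k j \<ge> 1" "n < N"
  shows "flat_partial N (Suc n) r k q =
    (\<Sum>m\<in>BZ_range N r. BZ_weight r k q m * discrete_monom N q (last_entry r m) n)"
  using assms(2,3)
proof (induction r arbitrary: n)
  case 0
  show ?case by (simp add: flat_partial_0 BZ_range_0 BZ_weight_def last_entry_def)
next
  case (Suc r)
  have pos: "\<forall>j\<in>{1..r}. k j \<ge> 1" and "1 \<le> k (Suc r)" using Suc.prems by auto
  \<comment> \<open>The inner induction runs over the length c of the last row, for all n because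
    removing a variable changes the bound.\<close>
  have "flat_partial N (Suc n) (Suc r) (k(Suc r := c)) q =
     (\<Sum>m\<in>BZ_range N (Suc r). BZ_weight (Suc r) (k(Suc r := c)) q m * discrete_monom N q (m (Suc r)) n)"
    if "1 \<le> c" "n < N" for c n
    using that
  proof (induction c arbitrary: n rule: dec_induct)
    case base
    let ?k = "k(Suc r := 1)"
    have weight: "BZ_weight r ?k q m = BZ_weight r k q m" for m
      by (auto simp: BZ_weight_def intro!: prod.cong)
    have IH: "flat_partial N a r ?k q =
        (\<Sum>m\<in>BZ_range N r. BZ_weight r k q m * discrete_monom N q (last_entry r m) (a - 1))"
      if "a \<in> {1..n}" for a
    proof -
      have "flat_range a r ?k = flat_range a r k"
        by (auto simp: flat_range_def extensional_def)
      moreover have "flat_weight N r ?k q = flat_weight N r k q"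
        by (auto simp: flat_weight_def fun_eq_iff intro!: prod.cong)
      \<comment> \<open>The bound a is strict and a \<ge> 1, so the outer induction hypothesis is
        used at a - 1.\<close>
      ultimately have "flat_partial N a r ?k q = flat_partial N (Suc (a - 1)) r k q"
        using that by (simp add: flat_partial_def)
      then show ?thesis
        using Suc.IH [OF pos, of "a - 1"] that base.prems by auto
    qed
    have "flat_partial N (Suc n) (Suc r) ?k q = (\<Sum>a=1..n. flat_partial N a r ?k q / q_int q (N - a))"
      using pos by (intro flat_partial_first) auto
    also have "\<dots> = (\<Sum>a=1..n. \<Sum>m\<in>BZ_range N r. BZ_weight r k q m *
        (discrete_monom N q (last_entry r m) (a - 1) / q_int q (N - a)))"
      by (intro sum.cong refl) (simp only: IH sum_divide_distrib times_divide_eq_right)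
    also have "\<dots> = (\<Sum>m\<in>BZ_range N r. BZ_weight r k q m *
        (\<Sum>a=1..n. discrete_monom N q (last_entry r m) (a - 1) / q_int q (N - a)))"
      by (subst sum.swap) (simp add: sum_distrib_left)
    \<comment> \<open>The index b produced here becomes the new largest variable
      \<open>m (Suc r)\<close>.\<close>
    also have "\<dots> = (\<Sum>m\<in>BZ_range N r. BZ_weight r k q m *
        (\<Sum>b\<in>{last_entry r m<..<N}. discrete_monom N q b n / q_int q b))"
    proof (rule sum.cong [OF refl], rule arg_cong2 [where f = "(*)", OF refl])
      fix m assume "m \<in> BZ_range N r"
      then have "last_entry r m < N" using base.prems by (intro last_entry_less) auto
      then show "(\<Sum>a=1..n. discrete_monom N q (last_entry r m) (a - 1) / q_int q (N - a)) =
          (\<Sum>b\<in>{last_entry r m<..<N}. discrete_monom N q b n / q_int q b)"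
        by (intro sum_discrete_monom_flat nonzero) (use base.prems in auto)
    qed
    also have "\<dots> = (\<Sum>m\<in>BZ_range N (Suc r). BZ_weight (Suc r) ?k q m * discrete_monom N q (m (Suc r)) n)"
      by (simp add: sum_BZ_range_Suc BZ_weight_upd weight [simplified] sum_distrib_left)
    finally show ?case .
  next
    case (step c)
    let ?k = "k(Suc r := Suc c)" and ?k' = "k(Suc r := c)"
    have weight: "BZ_weight (Suc r) ?k q m =
        BZ_weight (Suc r) ?k' q m * (q ^ m (Suc r) / q_int q (m (Suc r)))" for m
    proof -
      have "BZ_weight r ?k q m = BZ_weight r ?k' q m"
        by (auto simp: BZ_weight_def intro!: prod.cong)
      \<comment> \<open>The exponent grows from (c - 1) m to c m; with truncated subtraction this
        relies on c \<ge> 1.\<close>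
      moreover have "q ^ (c * m (Suc r)) = q ^ ((c - 1) * m (Suc r)) * q ^ m (Suc r)"
        using step.hyps by (cases c) (simp_all flip: power_add add: add.commute)
      ultimately show ?thesis
        using BZ_weight_upd [of r ?k q m "m (Suc r)"] BZ_weight_upd [of r ?k' q m "m (Suc r)"]
        by (simp add: mult_ac)
    qed
    have "flat_partial N (Suc n) (Suc r) ?k q =
        (\<Sum>a=1..n. q ^ a / q_int q a * flat_partial N (Suc a) (Suc r) ?k' q)"
      using pos step.hyps by (intro flat_partial_next) auto
    also have "\<dots> = (\<Sum>a=1..n. \<Sum>m\<in>BZ_range N (Suc r). BZ_weight (Suc r) ?k' q m *
        (q ^ a / q_int q a * discrete_monom N q (m (Suc r)) a))"
      using step.prems by (intro sum.cong refl, subst step.IH)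
        (auto simp: sum_distrib_left mult_ac fun_upd_def)
    also have "\<dots> = (\<Sum>m\<in>BZ_range N (Suc r). BZ_weight (Suc r) ?k' q m *
        (\<Sum>a=1..n. q ^ a / q_int q a * discrete_monom N q (m (Suc r)) a))"
      by (subst sum.swap) (simp add: sum_distrib_left)
    \<comment> \<open>No new variable appears: the discrete monomial is an eigenfunction of this
      summation, and its eigenvalue q^m/[m] raises the exponent of [m] by one.\<close>
    also have "\<dots> = (\<Sum>m\<in>BZ_range N (Suc r). BZ_weight (Suc r) ?k' q m *
        (q ^ m (Suc r) / q_int q (m (Suc r)) * discrete_monom N q (m (Suc r)) n))"
    proof (rule sum.cong [OF refl], rule arg_cong2 [where f = "(*)", OF refl])
      fix m assume "m \<in> BZ_range N (Suc r)"
      then have "1 \<le> m (Suc r)" "m (Suc r) < N" by (auto simp: BZ_range_def Suc_le_eq)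
      then show "(\<Sum>a=1..n. q ^ a / q_int q a * discrete_monom N q (m (Suc r)) a) =
          q ^ m (Suc r) / q_int q (m (Suc r)) * discrete_monom N q (m (Suc r)) n"
        by (intro sum_discrete_monom_power nonzero) (use step.prems in auto)
    qed
    also have "\<dots> = (\<Sum>m\<in>BZ_range N (Suc r). BZ_weight (Suc r) ?k q m * discrete_monom N q (m (Suc r)) n)"
      by (simp only: weight mult.assoc)
    finally show ?case .
  qed
  \<comment> \<open>At c = \<open>k (Suc r)\<close> the update of \<open>k\<close> changes
    nothing.\<close>
  from this [OF \<open>1 \<le> k (Suc r)\<close> Suc.prems(2)] show ?case
    by (simp add: last_entry_def)
qed

theorem theorem1p2:
  fixes N r :: nat and q :: complex and k :: "nat \<Rightarrow> nat"
  assumes "N \<ge> 1"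
    and "q \<noteq> 1"
    and "\<forall>n. 1 \<le> n \<and> n \<le> N - 1 \<longrightarrow> q_int q n \<noteq> 0"
    and "r \<ge> 1"
    and "\<forall>j\<in>{1..r}. k j \<ge> 1"
  shows "zeta_BZ N r k q = zeta_flat N r k q"
proof -
  have nonzero: "\<And>n. 1 \<le> n \<Longrightarrow> n \<le> N - 1 \<Longrightarrow> q_int q n \<noteq> 0"
    using assms(3) by blast
  have "zeta_flat N r k q = flat_partial N (Suc (N - 1)) r k q"
    using assms(1) by (simp add: zeta_flat_eq)
  also have "\<dots> = (\<Sum>m\<in>BZ_range N r. BZ_weight r k q m * discrete_monom N q (last_entry r m) (N - 1))"
    using assms by (intro flat_partial_eq_sum_BZ_range nonzero) auto
  also have "\<dots> = (\<Sum>m\<in>BZ_range N r. BZ_weight r k q m)"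
  proof (intro sum.cong refl)
    fix m assume "m \<in> BZ_range N r"
    then have "last_entry r m \<le> N - 1"
      using last_entry_less assms(1) by fastforce
    then show "BZ_weight r k q m * discrete_monom N q (last_entry r m) (N - 1) = BZ_weight r k q m"
      using discrete_monom_top [OF nonzero] by simp
  qed
  finally show ?thesis by (simp add: zeta_BZ_eq)
qed

end
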